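(* For integers $1\le r\le n$ let $$T_r(n,q)=q^{r^2-r}\frac{(-q^{n-r+1};q)_r}{(-q;q)_r}\,{n-r+1\brack r}_q\, C_{n-r}(q).$$ Then $T_r(n,q)$ is a polynomial in $q$. If $n$ is even, $T_r(n,q)$ has only nonnegative coefficients. If $n$ is odd, $(1+q)T_r(n,q)$ has only nonnegative coefficients. Moreover, $T_r(2r-1,-q)$ has only nonnegative coefficients.
   Context: Notation: $[n]_q=1+q+\cdots+q^{n-1}$, $[n]_q!=[1]_q\cdots[n]_q$, $(x;q)_n=(1-x)(1-qx)\cdots(1-q^{n-1}x)$, ${m\brack k}_q=\frac{(q;q)_m}{(q;q)_k(q;q)_{m-k}}$ for $0\le k\le m$ and ${m\brack k}_q=0$ for $k>m\ge 0$, and $C_n(q)=\frac{1}{[n+1]_q}{2n\brack n}_q$ is the $q$-Catalan number. A polynomial is called positive if all its coefficients are nonnegative. *)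

theory Defs
  imports "HOL-Computational_Algebra.Polynomial"
begin

definition qint :: "nat \<Rightarrow> real \<Rightarrow> real" where
  "qint n q = (\<Sum>i<n. q ^ i)"

definition qpoch :: "real \<Rightarrow> real \<Rightarrow> nat \<Rightarrow> real" where
  "qpoch x q n = (\<Prod>i<n. 1 - q ^ i * x)"

definition qbinom :: "nat \<Rightarrow> nat \<Rightarrow> real \<Rightarrow> real" where
  "qbinom m k q = (if k \<le> m then qpoch q q m / (qpoch q q k * qpoch q q (m - k)) else 0)"

definition qcatalan :: "nat \<Rightarrow> real \<Rightarrow> real" where
  "qcatalan n q = qbinom (2 * n) n q / qint (n + 1) q"

definition T :: "nat \<Rightarrow> nat \<Rightarrow> real \<Rightarrow> real" where
  "T r n q = q ^ (r\<^sup>2 - r) * qpoch (- (q ^ (n - r + 1))) q r / qpoch (- q) q r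
             * qbinom (n - r + 1) r q * qcatalan (n - r) q"

definition positive_poly :: "real poly \<Rightarrow> bool" where
  "positive_poly p \<longleftrightarrow> (\<forall>i. coeff p i \<ge> 0)"

end

theory Submission
  imports Defs "HOL-Combinatorics.Transposition"
begin

text \<open>
  Put \<open>N = 2(n - r) + 1\<close> and \<open>d = gcd n N\<close>, which is odd and prime to \<open>r\<close>. Then \<open>T\<^sub>r(n,q)\<close> is
  \<open>q^(r\<^sup>2 - r) U(q\<^sup>2) V(q) / [N]\<close> with Gaussian polynomials \<open>U = [n choose r]\<close> and
  \<open>V = [N choose n]\<close>, and it factors into a power of \<open>q\<close>, the polynomial \<open>U / [d]\<close> at \<open>q\<^sup>2\<close>,
  the polynomial \<open>[d] V / [N]\<close>, and \<open>(1 + q^d) / (1 + q)\<close>.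
  As \<open>U\<close> and \<open>V\<close> are palindromic and unimodal, \<open>(1 - q) U\<close> and \<open>(1 - q) V\<close> have nonnegative
  coefficients in the lower half. Dividing such a polynomial by \<open>1 - q^M\<close> keeps these coefficients
  nonnegative, so palindromic quotients are positive. This applies to \<open>U / [d]\<close> and, for
  \<open>n < N\<close>, to the product of the last two factors. The remaining case \<open>n = N\<close> is \<open>n = 2r - 1\<close>;
  there \<open>V = 1\<close> and \<open>d = N\<close>, so that only \<open>(1 + q^d) / (1 + q)\<close> has negative coefficients, and
  they disappear after multiplication by \<open>1 + q\<close> or substitution of \<open>-q\<close>.
  Unimodality of Gaussian polynomials comes from the representation theory of sl(2): the raising
  operator is injective below the middle weight.
\<close>

subsection \<open>Subsets with prescribed cardinality and sum\<close>

text \<open>Gaussian elimination: a nonzero entry in row \<open>b\<close> expresses one unknown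
  through the others, leaving one equation and one unknown fewer. It will turn a target level that
  is too small into a kernel vector.\<close>

lemma underdetermined_nontrivial_solution:
  fixes M :: "'b \<Rightarrow> 'a \<Rightarrow> real"
  assumes "finite B" "finite A" "card B < card A"
  shows "\<exists>v. (\<exists>a\<in>A. v a \<noteq> 0) \<and> (\<forall>b\<in>B. (\<Sum>a\<in>A. M b a * v a) = 0)"
  using assms
proof (induction B arbitrary: A M rule: finite_induct)
  case empty
  then obtain a where "a \<in> A" by fastforce
  then show ?case by (intro exI[of _ "\<lambda>_. 1"]) auto
next
  case (insert b B)
  show ?case
  proof (cases "\<forall>a\<in>A. M b a = 0")
    case True
    have "card B < card A" using insert by simp
    from insert.IH[OF insert.prems(1) this, of M] True show ?thesis by auto
  next
    case False
    then obtain a0 where a0: "a0 \<in> A" "M b a0 \<noteq> 0" by auto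
    define M' where "M' c a = M c a - M c a0 * M b a / M b a0" for c a
    have "card B < card (A - {a0})" using insert a0 by simp
    from insert.IH[OF _ this, of M'] insert.prems obtain v where
      v: "\<exists>a\<in>A - {a0}. v a \<noteq> 0" "\<And>c. c \<in> B \<Longrightarrow> (\<Sum>a\<in>A - {a0}. M' c a * v a) = 0" by auto
    define s where "s = (\<Sum>a\<in>A - {a0}. M b a * v a)"
    define w where "w = v(a0 := - s / M b a0)"
    have sum_w: "(\<Sum>a\<in>A. M c a * w a) = (\<Sum>a\<in>A - {a0}. M c a * v a) - M c a0 * s / M b a0" for c
    proof -
      have "(\<Sum>a\<in>A. M c a * w a) = M c a0 * w a0 + (\<Sum>a\<in>A - {a0}. M c a * w a)"
        using insert.prems a0 by (intro sum.remove) auto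
      also have "(\<Sum>a\<in>A - {a0}. M c a * w a) = (\<Sum>a\<in>A - {a0}. M c a * v a)"
        by (intro sum.cong) (auto simp: w_def)
      finally show ?thesis by (simp add: w_def)
    qed
    have "(\<Sum>a\<in>A. M c a * w a) = 0" if "c \<in> B" for c
    proof -
      have "(\<Sum>a\<in>A - {a0}. M' c a * v a) =
          (\<Sum>a\<in>A - {a0}. M c a * v a) - M c a0 * s / M b a0"
        by (simp add: M'_def s_def left_diff_distrib sum_subtractf sum_distrib_left sum_divide_distrib mult.assoc)
      with v(2)[OF that] sum_w show ?thesis by simp
    qed
    moreover have "(\<Sum>a\<in>A. M b a * w a) = 0" using sum_w[of b] a0 by (simp add: s_def)
    moreover have "\<exists>a\<in>A. w a \<noteq> 0" using v(1) by (auto simp: w_def)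
    ultimately show ?thesis by auto
  qed
qed

text \<open>
  These are the sl(2) raising and lowering operators on an exterior power of the irreducible
  representation of dimension \<open>N\<close>, in the basis of \<open>k\<close>-subsets of \<open>{..<N}\<close>. With the square roots
  as coefficients the two operators are adjoint to each other.
\<close>

definition hop :: "nat \<Rightarrow> nat set \<Rightarrow> nat set" where
  "hop j S = transpose j (Suc j) ` S"

definition hop_weight :: "nat \<Rightarrow> nat \<Rightarrow> real" where
  "hop_weight N j = (real j + 1) * (real N - 1 - real j)"

definition raise_op :: "nat \<Rightarrow> (nat set \<Rightarrow> real) \<Rightarrow> nat set \<Rightarrow> real" where
  "raise_op N v S = (\<Sum>j<N-1. if Suc j \<in> S \<and> j \<notin> S then sqrt (hop_weight N j) * v (hop j S) else 0)"

definition lower_op :: "nat \<Rightarrow> (nat set \<Rightarrow> real) \<Rightarrow> nat set \<Rightarrow> real" where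
  "lower_op N v S = (\<Sum>j<N-1. if j \<in> S \<and> Suc j \<notin> S then sqrt (hop_weight N j) * v (hop j S) else 0)"

lemma hop_hop [simp]: "hop j (hop j S) = S"
  by (simp add: hop_def image_image)

lemma mem_hop: "x \<in> hop j S \<longleftrightarrow> transpose j (Suc j) x \<in> S"
  unfolding hop_def by (metis (no_types, lifting) image_iff transpose_involutory)

lemma hop_commute: "Suc i < j \<Longrightarrow> hop i (hop j S) = hop j (hop i S)"
  by (rule set_eqI) (auto simp: mem_hop transpose_def)

lemma hop_subset: "S \<subseteq> {..<N} \<Longrightarrow> j < N - 1 \<Longrightarrow> hop j S \<subseteq> {..<N}"
  by (auto simp: hop_def transpose_def)

lemma bij_hop: "j < N - 1 \<Longrightarrow> bij_betw (hop j) (Pow {..<N}) (Pow {..<N})"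
  by (rule bij_betw_byWitness[of _ "hop j"]) (auto dest: hop_subset)

lemma sum_hop: "j < N - 1 \<Longrightarrow> (\<Sum>S\<in>Pow {..<N}. f (hop j S)) = (\<Sum>S\<in>Pow {..<N}. f S)"
  by (rule sum.reindex_bij_betw[OF bij_hop])

lemma card_hop [simp]: "card (hop j S) = card S"
  unfolding hop_def by (rule card_image) (metis inj_onI transpose_involutory)

lemma sum_elems_hop:
  assumes "finite S" "Suc j \<in> S" "j \<notin> S"
  shows "\<Sum>S = Suc (\<Sum>(hop j S))"
proof -
  have "hop j S = insert j (S - {Suc j})"
    using assms by (auto simp: hop_def transpose_def image_iff)
  moreover have "\<Sum>S = Suc j + \<Sum>(S - {Suc j})" using assms by (simp add: sum.remove)
  ultimately show ?thesis using assms by simp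
qed

text \<open>Reindexing by the two commuting hops; for adjacent positions both sides vanish.\<close>

lemma hop_cross_terms:
  assumes "i < N - 1" "j < N - 1" "i \<noteq> j"
  shows "(\<Sum>S\<in>Pow {..<N}.
      (if Suc i \<in> S \<and> i \<notin> S then a * v (hop i S) else 0) *
      (if Suc j \<in> S \<and> j \<notin> S then b * v (hop j S) else 0 :: real)) =
    (\<Sum>S\<in>Pow {..<N}.
      (if i \<in> S \<and> Suc i \<notin> S then a * v (hop i S) else 0) *
      (if j \<in> S \<and> Suc j \<notin> S then b * v (hop j S) else 0))"
  (is "(\<Sum>S\<in>_. ?f S) = (\<Sum>S\<in>_. ?g S)")
proof (cases "Suc i = j \<or> Suc j = i")
  case True
  then have "?f S = 0" "?g S = 0" for S by auto
  then show ?thesis by (simp only:)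
next
  case False
  have comm: "hop i (hop j S) = hop j (hop i S)" for S
    using hop_commute[of i j S] hop_commute[of j i S] False assms(3) by (cases "i < j") auto
  have "?f (hop i (hop j S)) = ?g S" for S
  proof -
    have "hop i (hop i (hop j S)) = hop j S" "hop j (hop i (hop j S)) = hop i S"
      by (simp_all add: comm[symmetric])
    moreover have "Suc i \<in> hop i (hop j S) \<longleftrightarrow> i \<in> S" "i \<in> hop i (hop j S) \<longleftrightarrow> Suc i \<in> S"
      "Suc j \<in> hop i (hop j S) \<longleftrightarrow> j \<in> S" "j \<in> hop i (hop j S) \<longleftrightarrow> Suc j \<in> S"
      using False assms(3) by (auto simp: mem_hop transpose_def)
    ultimately show ?thesis by auto
  qed
  then have "(\<Sum>S\<in>Pow {..<N}. ?g S) = (\<Sum>S\<in>Pow {..<N}. ?f (hop i (hop j S)))" by simp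
  also have "\<dots> = (\<Sum>S\<in>Pow {..<N}. ?f (hop i S))" using assms(2) by (rule sum_hop)
  also have "\<dots> = (\<Sum>S\<in>Pow {..<N}. ?f S)" using assms(1) by (rule sum_hop)
  finally show ?thesis by simp
qed

text \<open>Summation by parts: N - 1 - 2j is the difference (j + 1)(N - 1 - j) - j(N - j) of
  neighbouring values of \<open>hop_weight\<close>, and the boundary terms vanish.\<close>

lemma sum_weight_differences:
  assumes "R \<subseteq> {..<N}"
  shows "(\<Sum>j<N-1. hop_weight N j * (of_bool (j \<in> R) - of_bool (Suc j \<in> R))) =
    (\<Sum>j\<in>R. real N - 1 - 2 * real j)"
proof (cases N)
  case 0
  then show ?thesis using assms by simp
next
  case (Suc M)
  define g where "g j = hop_weight N j * of_bool (j \<in> R)" for j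
  \<comment> \<open>The factor j(N - j) is the hop weight of the preceding position. It is 0 at j =
    0, just as the factor in \<open>g\<close> is 0 at j = N - 1, so both sums extend to all j <
    N.\<close>
  define h where "h j = real j * (real N - real j) * of_bool (j \<in> R)" for j
  have "(\<Sum>j<M. hop_weight N j * (of_bool (j \<in> R) - of_bool (Suc j \<in> R))) =
      (\<Sum>j<M. g j) - (\<Sum>j<M. h (Suc j))"
    unfolding sum_subtractf[symmetric]
    by (intro sum.cong) (auto simp: Suc g_def h_def hop_weight_def)
  also have "(\<Sum>j<M. g j) = (\<Sum>j<N. g j)" by (simp add: Suc g_def hop_weight_def)
  also have "(\<Sum>j<M. h (Suc j)) = (\<Sum>j<N. h j)"
    unfolding Suc by (subst sum.lessThan_Suc_shift) (simp add: h_def)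
  also have "(\<Sum>j<N. g j) - (\<Sum>j<N. h j) = (\<Sum>j<N. (real N - 1 - 2 * real j) * of_bool (j \<in> R))"
    unfolding sum_subtractf[symmetric]
    by (intro sum.cong) (auto simp: g_def h_def hop_weight_def algebra_simps)
  also have "\<dots> = (\<Sum>j\<in>R. real N - 1 - 2 * real j)"
    using assms by (intro sum.mono_neutral_cong_right) auto
  finally show ?thesis by (simp add: Suc)
qed

text \<open>The commutator relation of sl(2), read as a quadratic form.\<close>

lemma norm_raise_op:
  "(\<Sum>S\<in>Pow {..<N}. (raise_op N v S)\<^sup>2) =
   (\<Sum>S\<in>Pow {..<N}. (lower_op N v S)\<^sup>2) +
   (\<Sum>S\<in>Pow {..<N}. (v S)\<^sup>2 * (\<Sum>j\<in>S. real N - 1 - 2 * real j))"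
proof -
  define c where "c = (\<lambda>j. sqrt (hop_weight N j))"
  define f where "f j S = (if Suc j \<in> S \<and> j \<notin> S then c j * v (hop j S) else 0)" for j S
  define g where "g j S = (if j \<in> S \<and> Suc j \<notin> S then c j * v (hop j S) else 0)" for j S
  have expand: "(\<Sum>S\<in>Pow {..<N}. (\<Sum>j<N-1. F j S)\<^sup>2) =
      (\<Sum>i<N-1. \<Sum>j<N-1. \<Sum>S\<in>Pow {..<N}. F i S * F j S)" for F :: "nat \<Rightarrow> nat set \<Rightarrow> real"
    unfolding power2_eq_square sum_product
    by (subst sum.swap, rule sum.cong, simp, subst sum.swap, simp)
  have c2: "c j * c j = hop_weight N j" if "j < N - 1" for j
    using that by (simp add: c_def hop_weight_def)
  \<comment> \<open>Substituting \<open>hop j S\<close> for S turns both squares into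
    \<open>hop_weight N j\<close> times v(S)^2, restricted to sets containing only j, respectively
    only j + 1, of these two. The difference of the two indicators is the difference of the
    \<open>of_bool\<close> terms.\<close>
  have diag: "(\<Sum>S\<in>Pow {..<N}. f j S * f j S) = (\<Sum>S\<in>Pow {..<N}. g j S * g j S) +
     (\<Sum>S\<in>Pow {..<N}. (v S)\<^sup>2 * (hop_weight N j * (of_bool (j \<in> S) - of_bool (Suc j \<in> S))))"
    if j: "j < N - 1" for j
  proof -
    have "(\<Sum>S\<in>Pow {..<N}. f j S * f j S) - (\<Sum>S\<in>Pow {..<N}. g j S * g j S) =
       (\<Sum>S\<in>Pow {..<N}. f j (hop j S) * f j (hop j S)) - (\<Sum>S\<in>Pow {..<N}. g j (hop j S) * g j (hop j S))"
      using sum_hop[OF j, of "\<lambda>S. f j S * f j S"] sum_hop[OF j, of "\<lambda>S. g j S * g j S"] by simp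
    also have "\<dots> = (\<Sum>S\<in>Pow {..<N}. (v S)\<^sup>2 * (hop_weight N j * (of_bool (j \<in> S) - of_bool (Suc j \<in> S))))"
      unfolding sum_subtractf[symmetric]
      by (intro sum.cong) (auto simp: f_def g_def mem_hop c2[OF j, symmetric] power2_eq_square)
    finally show ?thesis by simp
  qed
  have cross: "(\<Sum>S\<in>Pow {..<N}. f i S * f j S) = (\<Sum>S\<in>Pow {..<N}. g i S * g j S) +
     (if i = j then \<Sum>S\<in>Pow {..<N}. (v S)\<^sup>2 * (hop_weight N j * (of_bool (j \<in> S) - of_bool (Suc j \<in> S))) else 0)"
    if "i < N - 1" "j < N - 1" for i j
    using diag[of j] hop_cross_terms[OF that, of "c i" v "c j"] that
    by (cases "i = j") (auto simp: f_def g_def)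
  have "(\<Sum>S\<in>Pow {..<N}. (\<Sum>j<N-1. f j S)\<^sup>2) = (\<Sum>S\<in>Pow {..<N}. (\<Sum>j<N-1. g j S)\<^sup>2) +
     (\<Sum>j<N-1. \<Sum>S\<in>Pow {..<N}. (v S)\<^sup>2 * (hop_weight N j * (of_bool (j \<in> S) - of_bool (Suc j \<in> S))))"
    unfolding expand
    by (simp add: cross sum.distrib cong: sum.cong_simp del: One_nat_def)
  also have "(\<Sum>j<N-1. \<Sum>S\<in>Pow {..<N}. (v S)\<^sup>2 * (hop_weight N j * (of_bool (j \<in> S) - of_bool (Suc j \<in> S)))) =
     (\<Sum>S\<in>Pow {..<N}. (v S)\<^sup>2 * (\<Sum>j\<in>S. real N - 1 - 2 * real j))"
    by (subst sum.swap, intro sum.cong) (auto simp: sum_distrib_left[symmetric] sum_weight_differences simp del: One_nat_def)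
  finally show ?thesis
    unfolding raise_op_def lower_op_def f_def g_def c_def .
qed

section \<open>Comparison of levels with consecutive sums\<close>

definition subsets_of_sum :: "nat \<Rightarrow> nat \<Rightarrow> nat \<Rightarrow> nat set set" where
  "subsets_of_sum N k s = {S. S \<subseteq> {..<N} \<and> card S = k \<and> \<Sum>S = s}"

lemma finite_subsets_of_sum [simp]: "finite (subsets_of_sum N k s)"
  by (rule finite_subset[of _ "Pow {..<N}"]) (auto simp: subsets_of_sum_def)

text \<open>If level s + 1 were smaller than level s, \<open>raise_op\<close> would kill a nonzero
  function v on level s. There \<open>norm_raise_op\<close> says that the squared norm of the raised
  function is that of the lowered one plus c times that of v, with c = k(N - 1) - 2s > 0. This
  forces v = 0.\<close>

lemma card_subsets_of_sum_mono:
  assumes "2 * s < k * (N - 1)"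
  shows "card (subsets_of_sum N k s) \<le> card (subsets_of_sum N k (Suc s))"
proof (rule ccontr)
  let ?A = "subsets_of_sum N k s" and ?B = "subsets_of_sum N k (Suc s)"
  \<comment> \<open>The matrix of \<open>raise_op\<close> from level s to level s + 1.\<close>
  define M where "M S R = (\<Sum>j<N-1. if Suc j \<in> S \<and> j \<notin> S \<and> R = hop j S
    then sqrt (hop_weight N j) else 0)" for S R
  assume "\<not> ?thesis"
  then obtain u where u: "\<exists>R\<in>?A. u R \<noteq> 0" "\<And>S. S \<in> ?B \<Longrightarrow> (\<Sum>R\<in>?A. M S R * u R) = 0"
    using underdetermined_nontrivial_solution[of ?B ?A M] by force
  define v where "v R = (if R \<in> ?A then u R else 0)" for R
  \<comment> \<open>On level s + 1 this is the choice of \<open>u\<close>. From any other set, the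
    hops used by \<open>raise_op\<close> end outside level s, where v is 0.\<close>
  have raise: "raise_op N v S = 0" if "S \<subseteq> {..<N}" for S
  proof (cases "S \<in> ?B")
    case True
    have "(\<Sum>R\<in>?A. M S R * u R) = (\<Sum>j<N-1. \<Sum>R\<in>?A. if Suc j \<in> S \<and> j \<notin> S \<and> R = hop j S
        then sqrt (hop_weight N j) * u R else 0)"
      by (subst sum.swap) (auto simp: M_def sum_distrib_right intro!: sum.cong)
    also have "\<dots> = raise_op N v S"
      unfolding raise_op_def
    proof (intro sum.cong refl)
      fix j
      have "(\<Sum>R\<in>?A. if R = hop j S then sqrt (hop_weight N j) * u R else 0) =
          sqrt (hop_weight N j) * v (hop j S)" by (simp add: v_def)
      then show "(\<Sum>R\<in>?A. if Suc j \<in> S \<and> j \<notin> S \<and> R = hop j S then sqrt (hop_weight N j) * u R else 0) =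
          (if Suc j \<in> S \<and> j \<notin> S then sqrt (hop_weight N j) * v (hop j S) else 0)" by auto
    qed
    finally show ?thesis using u(2)[OF True] by simp
  next
    case False
    have fin: "finite S" using that finite_subset by blast
    have "v (hop j S) = 0" if j: "Suc j \<in> S" "j \<notin> S" for j
      using False sum_elems_hop[OF fin j] \<open>S \<subseteq> {..<N}\<close> by (auto simp: v_def subsets_of_sum_def)
    then show ?thesis by (auto simp: raise_op_def intro!: sum.neutral)
  qed
  define c where "c = real (k * (N - 1)) - 2 * real s"
  have c: "c > 0" using assms by (simp add: c_def flip: of_nat_mult)
  have "(v S)\<^sup>2 * (\<Sum>j\<in>S. real N - 1 - 2 * real j) = c * (v S)\<^sup>2" for S
  proof (cases "S \<in> ?A")
    case True
    have N: "N \<ge> 1" using assms by (cases N) auto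
    have "(\<Sum>j\<in>S. real N - 1 - 2 * real j) = real (card S) * (real N - 1) - 2 * real (\<Sum>S)"
      by (simp add: sum_subtractf sum_distrib_left[symmetric])
    also have "\<dots> = c" using True N by (simp add: c_def subsets_of_sum_def of_nat_diff)
    finally show ?thesis by simp
  qed (simp add: v_def)
  with norm_raise_op[of N v] raise
  have "(\<Sum>S\<in>Pow {..<N}. (lower_op N v S)\<^sup>2) + c * (\<Sum>S\<in>Pow {..<N}. (v S)\<^sup>2) = 0"
    by (simp add: sum_distrib_left)
  moreover have "(\<Sum>S\<in>Pow {..<N}. (lower_op N v S)\<^sup>2) \<ge> 0" by (intro sum_nonneg) auto
  moreover have nn: "(\<Sum>S\<in>Pow {..<N}. (v S)\<^sup>2) \<ge> 0" by (intro sum_nonneg) auto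
  ultimately have "(\<Sum>S\<in>Pow {..<N}. (v S)\<^sup>2) = 0"
    using c by (smt (verit) mult_pos_pos)
  then have "\<forall>S\<in>Pow {..<N}. v S = 0" by (subst (asm) sum_nonneg_eq_0_iff) auto
  with u(1) show False by (auto simp: v_def subsets_of_sum_def split: if_splits)
qed

subsection \<open>Gaussian polynomials\<close>

definition one_minus_pow :: "nat \<Rightarrow> real poly" where
  "one_minus_pow n = 1 - monom 1 n"

text \<open>This is (q;q)_n, that is (1 - q)^n [n]_q!; the powers of 1 - q cancel in Gaussian
  polynomials.\<close>

definition qfact_poly :: "nat \<Rightarrow> real poly" where
  "qfact_poly n = (\<Prod>i<n. one_minus_pow (Suc i))"

text \<open>The q-Pascal rule makes polynomiality automatic. Truncation in \<open>n - k\<close> is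
  harmless, since it occurs only for k > n, where the other factor is 0.\<close>

fun gauss_poly :: "nat \<Rightarrow> nat \<Rightarrow> real poly" where
  "gauss_poly n 0 = 1"
| "gauss_poly 0 (Suc k) = 0"
| "gauss_poly (Suc n) (Suc k) = gauss_poly n (Suc k) + monom 1 (n - k) * gauss_poly n k"

lemma one_minus_pow_0 [simp]: "one_minus_pow 0 = 0"
  by (simp add: one_minus_pow_def)

lemma one_minus_pow_add:
  "one_minus_pow (a + b) = one_minus_pow a + monom 1 a * one_minus_pow b"
  by (simp add: one_minus_pow_def right_diff_distrib mult_monom)

lemma coeff_0_one_minus_pow [simp]: "n > 0 \<Longrightarrow> coeff (one_minus_pow n) 0 = 1"
  by (simp add: one_minus_pow_def)

lemma one_minus_pow_nonzero [simp]: "one_minus_pow n = 0 \<longleftrightarrow> n = 0"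
  by (metis coeff_0 coeff_0_one_minus_pow neq0_conv one_minus_pow_0 zero_neq_one)

lemma degree_one_minus_pow [simp]: "degree (one_minus_pow n) = n"
proof (cases "n = 0")
  case False
  have "degree (1 - monom (1::real) n) = degree (- monom (1::real) n)"
    using False degree_add_eq_right[of 1 "- monom (1::real) n"] by (simp add: degree_monom_eq)
  then show ?thesis by (simp add: one_minus_pow_def degree_monom_eq)
qed simp

lemma degree_one_plus_monom: "n > 0 \<Longrightarrow> degree (1 + monom (1::real) n) = n"
  using degree_add_eq_right[of 1 "monom (1::real) n"] by (simp add: degree_monom_eq)

lemma reflect_one_minus_pow: "reflect_poly (one_minus_pow n) = - one_minus_pow n"
proof (cases "n = 0")
  case False
  show ?thesis
    by (rule poly_eqI) (use False in \<open>auto simp: coeff_reflect_poly\<close>, auto simp: one_minus_pow_def)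
qed simp

lemma reflect_one_plus_monom:
  assumes "n > 0"
  shows "reflect_poly (1 + monom (1::real) n) = 1 + monom 1 n"
  by (rule poly_eqI) (use assms in \<open>auto simp: coeff_reflect_poly degree_one_plus_monom\<close>)

lemma one_minus_pow_dvd: "one_minus_pow a dvd one_minus_pow (a * b)"
  using one_diff_power_eq[of "monom (1::real) a" b]
  by (simp add: one_minus_pow_def monom_power)

text \<open>With g = gcd b a and the Bezout relation bx = ay + g, one has 1 - q^g = (1 - q^(bx)) -
  q^g (1 - q^(ay)), so 1 - q^g lies in the ideal generated by 1 - q^a and 1 - q^b.\<close>

lemma dvd_mult_one_minus_pow_gcd:
  assumes "one_minus_pow a dvd G * one_minus_pow b" "b \<noteq> 0"
  shows "one_minus_pow a dvd G * one_minus_pow (gcd b a)"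
proof -
  obtain x y where xy: "b * x = a * y + gcd b a" using bezout_nat[OF assms(2)] by blast
  have eq: "G * one_minus_pow (gcd b a) =
      G * one_minus_pow (b * x) - G * monom 1 (gcd b a) * one_minus_pow (a * y)"
    unfolding xy by (simp add: add.commute[of "a * y"] one_minus_pow_add algebra_simps)
  have "one_minus_pow a dvd G * one_minus_pow (b * x)"
    by (rule dvd_trans[OF assms(1)]) (intro mult_dvd_mono dvd_refl one_minus_pow_dvd)
  then show ?thesis unfolding eq
    by (intro dvd_diff) (auto intro: dvd_mult one_minus_pow_dvd)
qed

lemma qfact_poly_0 [simp]: "qfact_poly 0 = 1"
  by (simp add: qfact_poly_def)

lemma qfact_poly_Suc: "qfact_poly (Suc n) = qfact_poly n * one_minus_pow (Suc n)"
  by (simp add: qfact_poly_def)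

lemma qfact_poly_nonzero [simp]: "qfact_poly n \<noteq> 0"
  by (simp add: qfact_poly_def)

lemma gauss_poly_eq_0: "n < k \<Longrightarrow> gauss_poly n k = 0"
  by (induction n k rule: gauss_poly.induct) auto

lemma gauss_poly_self [simp]: "gauss_poly n n = 1"
  by (induction n) (auto simp: gauss_poly_eq_0)

text \<open>The quotient formula without division. The induction step is q-Pascal combined with 1 -
  q^(l+k) = (1 - q^l) + q^l (1 - q^k).\<close>

lemma qfact_poly_eq_gauss:
  "qfact_poly (k + l) = qfact_poly k * qfact_poly l * gauss_poly (k + l) k"
proof (induction "k + l" arbitrary: k l)
  case (Suc n)
  show ?case
  proof (cases k)
    case (Suc k')
    show ?thesis
    proof (cases l)
      case 0
      then show ?thesis by simp
    next
      case (Suc l')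
      have IH1: "qfact_poly n = qfact_poly k * qfact_poly l' * gauss_poly n k"
        and IH2: "qfact_poly n = qfact_poly k' * qfact_poly l * gauss_poly n k'"
        using Suc.hyps(1)[of k l'] Suc.hyps(1)[of k' l] Suc.hyps(2) Suc \<open>k = Suc k'\<close> by auto
      have n: "k + l = Suc n" "n - k' = l" "Suc n = l + k" using Suc.hyps(2) \<open>k = Suc k'\<close> by auto
      have "qfact_poly k * qfact_poly l * gauss_poly (k + l) k =
          one_minus_pow l * (qfact_poly k * qfact_poly l' * gauss_poly n k) +
          monom 1 l * one_minus_pow k * (qfact_poly k' * qfact_poly l * gauss_poly n k')"
        unfolding n(1) by (simp add: \<open>k = Suc k'\<close> n(2)[unfolded \<open>k = Suc k'\<close>])
          (simp add: \<open>k = Suc k'\<close> Suc qfact_poly_Suc algebra_simps)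
      also have "\<dots> = (one_minus_pow l + monom 1 l * one_minus_pow k) * qfact_poly n"
        unfolding IH1[symmetric] IH2[symmetric] by (simp add: algebra_simps)
      also have "\<dots> = qfact_poly (Suc n)"
        by (simp add: qfact_poly_Suc one_minus_pow_add[of l k, folded n(3)] mult.commute)
      finally show ?thesis by (simp add: n(1))
    qed
  qed simp
qed simp

section \<open>Degree, symmetry and divisibility of Gaussian polynomials\<close>

lemma degree_qfact_poly: "2 * degree (qfact_poly n) = n * Suc n"
  by (induction n) (auto simp: qfact_poly_Suc degree_mult_eq)

lemma reflect_qfact_poly: "reflect_poly (qfact_poly n) = (- 1) ^ n * qfact_poly n"
  by (induction n) (simp_all add: qfact_poly_Suc reflect_poly_mult reflect_one_minus_pow)

lemma gauss_poly_nonzero: "k \<le> n \<Longrightarrow> gauss_poly n k \<noteq> 0"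
  using qfact_poly_eq_gauss[of k "n - k"] qfact_poly_nonzero[of n] by auto

lemma degree_gauss_poly:
  assumes "k \<le> n"
  shows "degree (gauss_poly n k) = k * (n - k)"
proof -
  obtain l where n: "n = k + l" using assms le_Suc_ex by blast
  have "degree (qfact_poly n) = degree (qfact_poly k) + degree (qfact_poly l) + degree (gauss_poly n k)"
    unfolding n qfact_poly_eq_gauss[of k l]
    using gauss_poly_nonzero[of k "k + l"] by (simp add: degree_mult_eq)
  with degree_qfact_poly[of n] degree_qfact_poly[of k] degree_qfact_poly[of l]
  have "k * Suc k + l * Suc l + 2 * degree (gauss_poly n k) = n * Suc n" by linarith
  then show ?thesis by (simp add: n algebra_simps)
qed

text \<open>Gaussian polynomials are palindromic because reflection only changes the sign of each
  factor 1 - q^i, and the signs in numerator and denominator cancel.\<close>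

lemma reflect_gauss_poly:
  assumes "k \<le> n"
  shows "reflect_poly (gauss_poly n k) = gauss_poly n k"
proof -
  obtain l where n: "n = k + l" using assms le_Suc_ex by blast
  have "reflect_poly (qfact_poly n) =
      reflect_poly (qfact_poly k) * reflect_poly (qfact_poly l) * reflect_poly (gauss_poly n k)"
    unfolding n qfact_poly_eq_gauss[of k l] by (simp add: reflect_poly_mult)
  then have "(- 1) ^ n * qfact_poly n =
      (- 1) ^ n * (qfact_poly k * qfact_poly l * reflect_poly (gauss_poly n k))"
    by (simp add: reflect_qfact_poly n power_add mult_ac)
  then have "qfact_poly n = qfact_poly k * qfact_poly l * reflect_poly (gauss_poly n k)"
    by simp
  then show ?thesis using qfact_poly_eq_gauss[of k l] by (simp add: n)
qed

lemma gauss_poly_absorption: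
  "gauss_poly (Suc n) (Suc k) * one_minus_pow (Suc k) = one_minus_pow (Suc n) * gauss_poly n k"
proof (cases "k \<le> n")
  case True
  then obtain l where n: "n = k + l" using le_Suc_ex by blast
  have "qfact_poly k * qfact_poly l * (gauss_poly (Suc n) (Suc k) * one_minus_pow (Suc k)) =
      qfact_poly (Suc n)"
    using qfact_poly_eq_gauss[of "Suc k" l] by (simp add: n qfact_poly_Suc[of k] mult_ac)
  also have "\<dots> = qfact_poly k * qfact_poly l * (one_minus_pow (Suc n) * gauss_poly n k)"
    using qfact_poly_eq_gauss[of k l] by (simp add: n qfact_poly_Suc[of "k + l"] mult_ac)
  finally show ?thesis by simp
qed (simp add: gauss_poly_eq_0 del: gauss_poly.simps)

lemma dvd_gauss_poly:
  assumes "0 < k" "0 < n"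
  shows "one_minus_pow n dvd gauss_poly n k * one_minus_pow k"
proof -
  obtain k' n' where "k = Suc k'" "n = Suc n'" using assms by (metis Suc_pred)
  then show ?thesis by (simp only: gauss_poly_absorption dvd_triv_left)
qed

text \<open>Sorting subsets by whether they contain the largest element n reproduces q-Pascal. The
  shift \<open>k choose 2\<close> is the least possible sum 0 + 1 + ... + (k - 1).\<close>

lemma sum_monom_subsets:
  "(\<Sum>S | S \<subseteq> {..<n} \<and> card S = k. monom 1 (\<Sum>S)) = monom 1 (k choose 2) * gauss_poly n k"
proof (induction n arbitrary: k)
  case 0
  have "{S. S \<subseteq> {..<0::nat} \<and> card S = k} = (if k = 0 then {{}} else {})" by auto
  then show ?case by (cases k) (simp_all only:, simp_all add: numeral_2_eq_2)
next
  case (Suc n)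
  show ?case
  proof (cases k)
    case 0
    have "{S. S \<subseteq> {..<Suc n} \<and> card S = 0} = {{}}"
    proof (intro equalityI subsetI)
      fix S assume "S \<in> {S. S \<subseteq> {..<Suc n} \<and> card S = 0}"
      then show "S \<in> {{}}" using finite_subset[of S "{..<Suc n}"] by simp
    qed simp
    then show ?thesis by (simp add: 0 numeral_2_eq_2)
  next
    case (Suc k')
    let ?F = "\<lambda>(n::nat) k. {S. S \<subseteq> {..<n} \<and> card S = k}"
    have fin: "finite (?F n k)" for n k by (rule finite_subset[of _ "Pow {..<n}"]) auto
    have fin_mem: "finite S" "n \<notin> S" if "S \<in> ?F n k" for S k
      using that finite_subset[of S "{..<n}"] by auto
    have inj: "inj_on (insert n) (?F n k')"
      by (rule inj_onI) (metis fin_mem(2) insert_ident)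
    have split: "?F (Suc n) k = ?F n k \<union> insert n ` ?F n k'" (is "?L = ?R")
    proof (intro equalityI subsetI)
      fix S assume S: "S \<in> ?L"
      then have [simp]: "finite S" using finite_subset[of S "{..<Suc n}"] by auto
      show "S \<in> ?R"
      proof (cases "n \<in> S")
        case True
        with S have "S - {n} \<in> ?F n k'" by (auto simp: Suc less_Suc_eq)
        moreover have "S = insert n (S - {n})" using True by auto
        ultimately show ?thesis by blast
      next
        case False
        with S show ?thesis by (auto simp: less_Suc_eq)
      qed
    next
      fix S assume "S \<in> ?R"
      then consider "S \<in> ?F n k" | R where "S = insert n R" "R \<in> ?F n k'" by blast
      then show "S \<in> ?L"
      proof cases
        case 1
        then show ?thesis using lessThan_Suc by blast
      next
        case 2
        then show ?thesis using fin_mem[OF 2(2)] lessThan_Suc[of n] Suc by auto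
      qed
    qed
    have "(\<Sum>S\<in>?F (Suc n) k. monom (1::real) (\<Sum>S)) =
        (\<Sum>S\<in>?F n k. monom 1 (\<Sum>S)) + (\<Sum>S\<in>insert n ` ?F n k'. monom 1 (\<Sum>S))"
      unfolding split by (intro sum.union_disjoint) (use fin in auto)
    also have "(\<Sum>S\<in>insert n ` ?F n k'. monom (1::real) (\<Sum>S)) = (\<Sum>S\<in>?F n k'. monom 1 n * monom 1 (\<Sum>S))"
      unfolding sum.reindex[OF inj] o_def
    proof (intro sum.cong refl)
      fix S assume "S \<in> ?F n k'"
      from fin_mem[OF this] show "monom (1::real) (\<Sum>(insert n S)) = monom 1 n * monom 1 (\<Sum>S)"
        by (simp add: mult_monom)
    qed
    also have "\<dots> = monom 1 n * (\<Sum>S\<in>?F n k'. monom 1 (\<Sum>S))" by (simp add: sum_distrib_left)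
    also have "\<dots> = monom 1 (k choose 2) * (monom 1 (n - k') * gauss_poly n k')"
    proof (cases "k' \<le> n")
      case True
      have "k choose 2 = (k' choose 2) + k'" by (simp add: Suc numeral_2_eq_2)
      then show ?thesis using True by (simp add: Suc.IH mult.assoc[symmetric] mult_monom add_ac)
    qed (simp add: Suc.IH gauss_poly_eq_0)
    finally show ?thesis by (simp add: Suc Suc.IH algebra_simps)
  qed
qed

lemma coeff_gauss_poly:
  "coeff (gauss_poly n k) i = real (card (subsets_of_sum n k (i + (k choose 2))))"
proof -
  let ?F = "{S. S \<subseteq> {..<n} \<and> card S = k}"
  have fin: "finite ?F" by (rule finite_subset[of _ "Pow {..<n}"]) auto
  have "coeff (gauss_poly n k) i = coeff (monom 1 (k choose 2) * gauss_poly n k) (i + (k choose 2))"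
    by (simp add: coeff_monom_mult)
  also have "\<dots> = (\<Sum>S\<in>?F. if \<Sum>S = i + (k choose 2) then 1 else 0)"
    by (simp add: sum_monom_subsets[symmetric] coeff_sum)
  also have "\<dots> = real (card (?F \<inter> {S. \<Sum>S = i + (k choose 2)}))"
    using fin by (simp add: sum.inter_filter[symmetric] Int_def)
  also have "?F \<inter> {S. \<Sum>S = i + (k choose 2)} = subsets_of_sum n k (i + (k choose 2))"
    by (auto simp: subsets_of_sum_def)
  finally show ?thesis .
qed

text \<open>The coefficients of (1 - q) times a Gaussian polynomial are the increments of its
  coefficients. Since 2 (k choose 2) + k(n - k) = k(n - 1), the middle of the polynomial corresponds
  to the middle of the possible sums, so \<open>card_subsets_of_sum_mono\<close> applies below
  it.\<close>

lemma gauss_poly_unimodal: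
  assumes "k \<le> n" "2 * i \<le> k * (n - k)"
  shows "coeff (one_minus_pow 1 * gauss_poly n k) i \<ge> 0"
proof (cases i)
  case 0
  then show ?thesis by (simp add: coeff_mult coeff_gauss_poly)
next
  case (Suc j)
  have c: "2 * (k choose 2) = k * (k - 1)" by (cases k) (simp_all add: choose_two)
  have "2 * (j + (k choose 2)) < k * (n - 1)"
  proof (cases k)
    case 0
    then show ?thesis using assms Suc by simp
  next
    case (Suc k')
    obtain l where n: "n = k + l" using assms le_Suc_ex by blast
    then have "k * (n - 1) = k * (k - 1) + k * (n - k)" by (simp add: Suc algebra_simps)
    then show ?thesis using c assms(2) \<open>i = Suc j\<close> by simp
  qed
  from card_subsets_of_sum_mono[OF this]
  have "coeff (gauss_poly n k) j \<le> coeff (gauss_poly n k) i"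
    by (simp add: coeff_gauss_poly Suc)
  then show ?thesis
    by (simp add: one_minus_pow_def left_diff_distrib coeff_monom_mult Suc)
qed

subsection \<open>Positivity\<close>

lemma positive_poly_add: "positive_poly p \<Longrightarrow> positive_poly q \<Longrightarrow> positive_poly (p + q)"
  by (simp add: positive_poly_def)

lemma positive_poly_mult: "positive_poly p \<Longrightarrow> positive_poly q \<Longrightarrow> positive_poly (p * q)"
  by (auto simp: positive_poly_def coeff_mult intro!: sum_nonneg)

lemma positive_poly_sum: "(\<And>i. i \<in> I \<Longrightarrow> positive_poly (f i)) \<Longrightarrow> positive_poly (sum f I)"
  by (auto simp: positive_poly_def coeff_sum intro!: sum_nonneg)

lemma positive_poly_monom [simp]: "c \<ge> 0 \<Longrightarrow> positive_poly (monom c n)"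
  by (simp add: positive_poly_def)

lemma positive_poly_0 [simp]: "positive_poly 0"
  by (simp add: positive_poly_def)

lemma positive_poly_1 [simp]: "positive_poly 1"
  by (simp add: positive_poly_def)

lemma positive_poly_pcompose:
  assumes "positive_poly p" "positive_poly q"
  shows "positive_poly (pcompose p q)"
  using assms(1)
proof (induction p)
  case (pCons a p)
  have "a \<ge> 0" "positive_poly p"
    using pCons.prems unfolding positive_poly_def
    by (metis coeff_pCons_0) (metis coeff_pCons_Suc pCons.prems positive_poly_def)
  then have "positive_poly ([:a:] + q * pcompose p q)"
    using pCons.IH assms(2) by (intro positive_poly_add positive_poly_mult) (auto simp flip: monom_0)
  then show ?case by (simp add: pcompose_pCons)
qed simp

lemma pcompose_monom_left: "pcompose (monom c n) q = smult c (q ^ n)"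
  by (induction n) (simp_all add: monom_0 monom_Suc pcompose_pCons)

lemma coeff_mult_nonneg:
  fixes p q :: "real poly"
  assumes "\<And>j. j \<le> i \<Longrightarrow> coeff p j \<ge> 0" "positive_poly q"
  shows "coeff (p * q) i \<ge> 0"
  using assms by (auto simp: coeff_mult positive_poly_def intro!: sum_nonneg)

text \<open>
  Division by \<open>1 - q^M\<close> preserves nonnegativity of the initial coefficients, and the palindromic
  symmetry of the quotient transfers nonnegativity from its lower to its upper half.
\<close>

lemma positive_poly_quotient:
  fixes t b :: "real poly"
  assumes eq: "t * one_minus_pow M = b" and M: "M > 0"
    and palindromic: "reflect_poly t = t"
    and nonneg: "\<And>j. 2 * j \<le> degree t \<Longrightarrow> coeff b j \<ge> 0"
  shows "positive_poly t"
  unfolding positive_poly_def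
proof
  have t: "t = b + monom 1 M * t"
    using eq by (auto simp: one_minus_pow_def algebra_simps)
  have half: "coeff t i \<ge> 0" if "2 * i \<le> degree t" for i
    using that
  proof (induction i rule: less_induct)
    case (less i)
    have "coeff t i = coeff b i + (if i < M then 0 else coeff t (i - M))"
      by (subst t) (simp add: coeff_monom_mult)
    moreover have "coeff t (i - M) \<ge> 0" if "\<not> i < M"
      using less that M by auto
    ultimately show ?case using nonneg[OF less.prems] by auto
  qed
  fix i
  consider "2 * i \<le> degree t" | "i > degree t" | "2 * (degree t - i) \<le> degree t" "i \<le> degree t"
    by linarith
  then show "coeff t i \<ge> 0"
  proof cases
    case 3
    then have "coeff t i = coeff t (degree t - i)"
      by (subst palindromic[symmetric]) (simp add: coeff_reflect_poly)
    with half[OF 3(1)] show ?thesis by simp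
  qed (use half in \<open>auto simp: coeff_eq_0\<close>)
qed

text \<open>The quotient t is the Gaussian polynomial divided by [d]. Divisibility follows from
  \<open>dvd_gauss_poly\<close> and gcd(k, d) = 1; positivity follows from unimodality.\<close>

lemma gauss_poly_quotient:
  assumes "0 < k" "k \<le> n" "d dvd n" "coprime d k"
  obtains t where "t * one_minus_pow d = one_minus_pow 1 * gauss_poly n k" "positive_poly t"
proof -
  have d: "d > 0" using assms by (auto intro: Nat.gr0I)
  have "one_minus_pow d dvd one_minus_pow n" using assms(3) one_minus_pow_dvd by (auto elim: dvdE)
  also have "one_minus_pow n dvd gauss_poly n k * one_minus_pow k"
    using assms by (intro dvd_gauss_poly) auto
  finally have "one_minus_pow d dvd gauss_poly n k * one_minus_pow (gcd k d)"
    using assms(1) by (intro dvd_mult_one_minus_pow_gcd) auto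
  also have "gcd k d = 1" using assms(4) by (simp add: coprime_iff_gcd_eq_1 gcd.commute)
  finally obtain t where "gauss_poly n k * one_minus_pow 1 = one_minus_pow d * t" by (elim dvdE)
  then have t: "t * one_minus_pow d = one_minus_pow 1 * gauss_poly n k"
    by (simp only: mult.commute)
  have nz: "t \<noteq> 0" using t gauss_poly_nonzero[OF assms(2)] by auto
  have "reflect_poly t * reflect_poly (one_minus_pow d) =
      reflect_poly (one_minus_pow 1) * reflect_poly (gauss_poly n k)"
    by (simp only: reflect_poly_mult[symmetric] t)
  then have "reflect_poly t * one_minus_pow d = t * one_minus_pow d"
    by (simp add: reflect_one_minus_pow reflect_gauss_poly assms(2) t)
  then have "reflect_poly t = t" using d by simp
  \<comment> \<open>As d is at least 1, the degree of t is at most k(n - k), so its lower half lies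
    within the range of \<open>gauss_poly_unimodal\<close>.\<close>
  moreover have "degree t + d = 1 + k * (n - k)"
    using arg_cong[OF t, of degree] nz d gauss_poly_nonzero[OF assms(2)]
    by (simp add: degree_mult_eq degree_gauss_poly[OF assms(2)])
  ultimately have "positive_poly t"
    using d by (intro positive_poly_quotient[OF t d] gauss_poly_unimodal assms(2)) auto
  with t that show ?thesis by blast
qed

text \<open>For odd \<open>d\<close> this is \<open>(1 + q^d) / (1 + q)\<close>.\<close>

definition alt_poly :: "nat \<Rightarrow> real poly" where
  "alt_poly d = (\<Sum>i<d. monom ((- 1) ^ i) i)"

lemma alt_poly_mult:
  assumes "odd d"
  shows "(1 + monom 1 1) * alt_poly d = 1 + monom 1 d"
proof -
  have "alt_poly d = (\<Sum>i<d. monom (- 1) 1 ^ i)"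
    unfolding alt_poly_def by (intro sum.cong) (auto simp: monom_power)
  then have "(1 - monom (- 1) 1) * alt_poly d = 1 - monom (- 1) 1 ^ d"
    by (simp only: one_diff_power_eq)
  then show ?thesis using assms by (simp add: monom_power flip: minus_monom)
qed

text \<open>With G the Gaussian polynomial, the product is G (1 - q^(2d)) / ((1 - q^N)(1 + q)).
  Extending the fraction by 1 + q^N gives (1 - q) G (1 + q^N) S / (1 - q^(2N)) with S = (1 - q^(2d))
  / (1 - q^2) positive, so \<open>positive_poly_quotient\<close> applies with M = 2N.\<close>

lemma positive_rational_gauss_poly:
  assumes N: "odd N" and k: "0 < k" "k < N" and d: "d = gcd k N"
    and y: "y * one_minus_pow N = gauss_poly N k * one_minus_pow d"
  shows "positive_poly (y * alt_poly d)"
proof -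
  define S :: "real poly" where "S = (\<Sum>i<d. monom 1 (2 * i))"
  have odd_d: "odd d" using N d by (meson dvd_trans gcd_dvd2)
  then have d0: "d > 0" by (auto intro: Nat.gr0I)
  have S: "S * one_minus_pow 2 = one_minus_pow (2 * d)"
    using one_diff_power_eq[of "monom (1::real) 2" d]
    by (simp add: S_def one_minus_pow_def monom_power mult.commute)
  have split: "one_minus_pow (2 * j) = one_minus_pow j * (1 + monom 1 j)" for j
    by (simp add: one_minus_pow_def distrib_left left_diff_distrib mult_monom mult_2)
  \<comment> \<open>Multiplied by 1 + q, both sides become 1 - q^(2d).\<close>
  have alt: "one_minus_pow d * alt_poly d = one_minus_pow 1 * S"
  proof -
    have "(1 + monom 1 1) * (one_minus_pow d * alt_poly d) = one_minus_pow (2 * d)"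
      unfolding split[of d] alt_poly_mult[OF odd_d, symmetric] by (simp only: mult_ac)
    also have "\<dots> = (1 + monom 1 1) * (one_minus_pow 1 * S)"
      using S split[of 1] by (simp add: mult_ac)
    finally show ?thesis
      using degree_one_plus_monom[of 1] by (metis degree_0 mult_left_cancel zero_less_one zero_neq_one)
  qed
  let ?t = "y * alt_poly d"
  let ?b = "one_minus_pow 1 * gauss_poly N k * ((1 + monom 1 N) * S)"
  have t: "?t * one_minus_pow (2 * N) = ?b"
  proof -
    have "?t * one_minus_pow (2 * N) = (y * one_minus_pow N) * (alt_poly d * (1 + monom 1 N))"
      unfolding split[of N] by (simp only: mult_ac)
    also have "\<dots> = gauss_poly N k * (1 + monom 1 N) * (one_minus_pow d * alt_poly d)"
      by (simp only: y mult_ac)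
    also have "\<dots> = ?b" unfolding alt by (simp only: mult_ac)
    finally show ?thesis .
  qed
  have S0: "S \<noteq> 0" using S d0 by (metis mult_zero_left one_minus_pow_nonzero mult_is_0 neq0_conv zero_neq_numeral)
  have degree_S: "degree S + 2 = 2 * d"
    using arg_cong[OF S, of degree] S0 by (simp add: degree_mult_eq)
  have reflect_S: "reflect_poly S = S"
  proof -
    have "reflect_poly S * reflect_poly (one_minus_pow 2) = reflect_poly (one_minus_pow (2 * d))"
      by (simp only: reflect_poly_mult[symmetric] S)
    then have "reflect_poly S * one_minus_pow 2 = S * one_minus_pow 2"
      by (simp add: reflect_one_minus_pow S)
    then show ?thesis by simp
  qed
  have N0: "N > 0" and kN: "k \<le> N" using k by auto
  have G0: "gauss_poly N k \<noteq> 0" by (rule gauss_poly_nonzero[OF kN])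
  have P0: "1 + monom (1::real) N \<noteq> 0" using degree_one_plus_monom[OF N0] N0 by (metis degree_0 less_irrefl)
  have t0: "?t \<noteq> 0"
  proof
    assume "?t = 0"
    with t have "?b = 0" by (metis mult_zero_left)
    then show False using S0 G0 P0 by auto
  qed
  have "reflect_poly ?t * reflect_poly (one_minus_pow (2 * N)) = reflect_poly ?b"
    by (simp only: reflect_poly_mult[symmetric] t)
  also have "\<dots> = - ?b"
    by (simp add: reflect_poly_mult reflect_one_minus_pow reflect_gauss_poly[OF kN] reflect_S
        reflect_one_plus_monom[OF N0])
  finally have "reflect_poly ?t * one_minus_pow (2 * N) = ?t * one_minus_pow (2 * N)"
    by (simp only: reflect_one_minus_pow t mult_minus_right neg_equal_iff_equal)
  then have palindromic: "reflect_poly ?t = ?t" using N0 by simp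
  have "degree ?t + 2 * N = degree ?b"
    using degree_mult_eq[OF t0, of "one_minus_pow (2 * N)"] N0 unfolding t by simp
  also have "\<dots> = 1 + k * (N - k) + (N + degree S)"
    using S0 G0 P0
    by (simp add: degree_mult_eq degree_gauss_poly[OF kN] degree_one_plus_monom[OF N0])
  finally have "degree ?t + 2 * N = 1 + k * (N - k) + (N + degree S)" .
  \<comment> \<open>Here k < N enters: d is a proper divisor of N. The bound keeps the degree k(N -
    k) + 2d - N - 1 of the quotient within the range where unimodality gives signs.\<close>
  moreover have "2 * d \<le> N"
  proof -
    obtain e where e: "N = d * e" using d by (meson dvdE gcd_dvd2)
    have "d \<le> k" using d k by (simp add: gcd_le1_nat)
    with e k have "e \<noteq> 1" by auto
    moreover have "e \<noteq> 0" using e k by (metis mult_0_right not_less_zero)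
    ultimately have "2 \<le> e" by linarith
    then show ?thesis using e by (metis mult.commute mult_le_mono2)
  qed
  ultimately have degree_t: "degree ?t \<le> k * (N - k)" using degree_S by linarith
  show ?thesis
  proof (rule positive_poly_quotient[OF t _ palindromic])
    fix j assume "2 * j \<le> degree ?t"
    with degree_t have j: "2 * j \<le> k * (N - k)" by linarith
    show "coeff ?b j \<ge> 0"
    proof (rule coeff_mult_nonneg)
      show "positive_poly ((1 + monom 1 N) * S)"
        unfolding S_def by (intro positive_poly_mult positive_poly_add positive_poly_sum) auto
      show "coeff (one_minus_pow 1 * gauss_poly N k) i \<ge> 0" if "i \<le> j" for i
        using that j by (intro gauss_poly_unimodal kN) auto
    qed
  qed (use N0 in auto)
qed

section \<open>Expressing T through Gaussian polynomials\<close>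

lemma poly_qfact_poly: "poly (qfact_poly n) q = qpoch q q n"
  by (simp add: qfact_poly_def one_minus_pow_def qpoch_def poly_prod poly_monom mult.commute)

text \<open>The factorization 1 - q^(2i) = (1 - q^i)(1 + q^i) is what absorbs the factors (-q;q) of
  T into a Gaussian polynomial at q^2.\<close>

lemma poly_qfact_poly_square: "poly (qfact_poly n) (q\<^sup>2) = qpoch q q n * qpoch (- q) q n"
  unfolding qfact_poly_def qpoch_def poly_prod prod.distrib[symmetric]
  by (intro prod.cong)
    (auto simp: one_minus_pow_def poly_monom power2_eq_square power_mult_distrib algebra_simps)

lemma qpoch_minus_add: "qpoch (- (q ^ (m + 1))) q r * qpoch (- q) q m = qpoch (- q) q (m + r)"
  by (induction r) (auto simp: qpoch_def power_add mult_ac)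

text \<open>On this interval no denominator of T vanishes, and it has infinitely many points, so
  agreement there determines a polynomial.\<close>

lemma qpoch_nonzero:
  assumes "0 < q" "q < 1"
  shows "qpoch q q n \<noteq> 0" "qpoch (- q) q n \<noteq> 0"
proof -
  have "1 - q ^ i * q \<noteq> 0" for i
    using assms power_Suc_less_one[of q i] by (simp add: mult.commute)
  moreover have "1 + q ^ i * q \<noteq> 0" for i
    using assms by (metis add_pos_pos less_irrefl mult_pos_pos zero_less_one zero_less_power)
  ultimately show "qpoch q q n \<noteq> 0" "qpoch (- q) q n \<noteq> 0" by (simp_all add: qpoch_def)
qed

text \<open>Written in \<open>P\<close> and \<open>Q\<close>, both sides become the same quotient.
  The factor 1 - q^(m+1) from the binomial in T cancels against the Catalan denominator, and (1 - q)
  / (1 - q^(2m+1)) is 1 / [2m+1].\<close>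

lemma T_eq_gauss:
  assumes "r \<le> m + 1" "0 < q" "q < 1"
  shows "T r (m + r) q = q ^ (r\<^sup>2 - r) * poly (gauss_poly (m + r) r) (q\<^sup>2) *
    poly (gauss_poly (2 * m + 1) (m + r)) q * (1 - q) / (1 - q ^ (2 * m + 1))"
proof -
  define l where "l = m + 1 - r"
  define P where "P = qpoch q q"
  define Q where "Q = qpoch (- q) q"
  have nz: "P i \<noteq> 0" "Q i \<noteq> 0" for i using qpoch_nonzero[OF assms(2,3)] by (auto simp: P_def Q_def)
  have q1: "1 - q ^ Suc i \<noteq> 0" for i using assms power_Suc_less_one[of q i] by simp
  have PS: "P (Suc i) = P i * (1 - q ^ Suc i)" for i by (simp add: P_def qpoch_def mult.commute)
  have U: "P (m + r) * Q (m + r) = P r * Q r * (P m * Q m) * poly (gauss_poly (m + r) r) (q\<^sup>2)"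
    using arg_cong[OF qfact_poly_eq_gauss[of r m], of "\<lambda>p. poly p (q\<^sup>2)"]
    by (simp add: poly_qfact_poly_square P_def Q_def add.commute)
  have N: "2 * m + 1 = (m + r) + l" using assms(1) by (simp add: l_def)
  have V: "P (2 * m) * (1 - q ^ (2 * m + 1)) =
      P (m + r) * P l * poly (gauss_poly (2 * m + 1) (m + r)) q"
    using arg_cong[OF qfact_poly_eq_gauss[of "m + r" l], of "\<lambda>p. poly p q"] PS[of "2 * m"]
    unfolding N[symmetric] by (simp add: poly_qfact_poly P_def)
  have qint: "qint (m + 1) q = (1 - q ^ Suc m) / (1 - q)"
    using assms one_diff_power_eq[of q "m + 1"] by (simp add: qint_def field_simps)
  have U': "poly (gauss_poly (m + r) r) (q\<^sup>2) = P (m + r) * Q (m + r) / (P r * Q r * (P m * Q m))"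
    using U nz by (simp add: field_simps)
  have V': "poly (gauss_poly (2 * m + 1) (m + r)) q =
      P (2 * m) * (1 - q ^ (2 * m + 1)) / (P (m + r) * P l)"
    using V nz by (simp add: field_simps)
  have Q': "qpoch (- (q ^ (m + 1))) q r = Q (m + r) / Q m"
    using qpoch_minus_add[of q m r] nz by (simp add: Q_def field_simps)
  have "T r (m + r) q = q ^ (r\<^sup>2 - r) * (Q (m + r) / Q m) / Q r *
      (P m * (1 - q ^ Suc m) / (P r * P l)) * (P (2 * m) / (P m * P m) / ((1 - q ^ Suc m) / (1 - q)))"
    using assms(1) PS[of m] Q' qint
    by (simp add: T_def qbinom_def qcatalan_def P_def[symmetric] Q_def[symmetric] l_def)
  also have "\<dots> = q ^ (r\<^sup>2 - r) * (Q (m + r) * P (2 * m) * (1 - q)) / (Q m * Q r * P r * P l * P m)"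
    using q1[of m] nz assms by (simp add: divide_simps del: power_Suc)
  also have "\<dots> = q ^ (r\<^sup>2 - r) * poly (gauss_poly (m + r) r) (q\<^sup>2) *
      poly (gauss_poly (2 * m + 1) (m + r)) q * (1 - q) / (1 - q ^ (2 * m + 1))"
    unfolding U' V' using q1[of "2 * m"] nz by (simp add: divide_simps del: power_Suc)
  finally show ?thesis .
qed

theorem theorem4p2:
  fixes r n :: nat
  assumes "1 \<le> r" and "r \<le> n"
  shows "\<exists>p :: real poly.
           (\<forall>q::real. 0 < q \<and> q < 1 \<longrightarrow> T r n q = poly p q)
         \<and> (even n \<longrightarrow> positive_poly p)
         \<and> (odd n \<longrightarrow> positive_poly ([:1, 1:] * p))
         \<and> (n = 2 * r - 1 \<longrightarrow> positive_poly (pcompose p [:0, -1:]))"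
proof (cases "n < 2 * r - 1")
  \<comment> \<open>Here n - r + 1 < r, so the binomial in T is 0 by convention and p = 0
    works.\<close>
  case True
  then have "T r n q = 0" for q using assms by (simp add: T_def qbinom_def)
  with True show ?thesis by (intro exI[of _ 0]) simp
next
  case False
  obtain m where n: "n = m + r" using assms(2) by (metis le_add_diff_inverse2)
  have rm: "r \<le> m + 1" using False n by linarith
  define N where "N = 2 * m + 1"
  define d where "d = gcd n N"
  have N: "odd N" "N > 0" by (auto simp: N_def)
  have dn: "d dvd n" and dN: "d dvd N" by (simp_all add: d_def)
  have odd_d: "odd d" using dN N by (meson dvd_trans)
  \<comment> \<open>A common divisor of d and r divides n - r = m as well as N = 2m + 1.\<close>
  have "coprime d r"
  proof (rule coprimeI)
    fix c assume c: "c dvd d" "c dvd r"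
    with dn dN have "c dvd n" "c dvd N" by (auto intro: dvd_trans)
    then have "c dvd 2 * m" using n c(2) by (simp add: dvd_add_left_iff)
    with \<open>c dvd N\<close> show "is_unit c" unfolding N_def by (metis dvd_add_right_iff)
  qed
  then obtain t where t: "t * one_minus_pow d = one_minus_pow 1 * gauss_poly n r" "positive_poly t"
    using gauss_poly_quotient[of r n d] assms dn by auto
  have "one_minus_pow N dvd gauss_poly N n * one_minus_pow d"
    unfolding d_def using assms N by (intro dvd_mult_one_minus_pow_gcd dvd_gauss_poly) auto
  then obtain y where "gauss_poly N n * one_minus_pow d = one_minus_pow N * y" by (elim dvdE)
  then have y: "y * one_minus_pow N = gauss_poly N n * one_minus_pow d"
    by (simp only: mult.commute)
  \<comment> \<open>The factor U / [d] at q^2; it contains only even powers of q.\<close>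
  define s where "s = pcompose t (monom 1 2)"
  have s: "positive_poly s" unfolding s_def by (intro positive_poly_pcompose t(2)) simp
  define p where "p = monom 1 (r\<^sup>2 - r) * s * (y * alt_poly d)"
  have eval: "T r n q = poly p q" if q: "0 < q" "q < 1" for q
  proof -
    have q1: "1 - q ^ i \<noteq> 0" if "i > 0" for i using q that power_less_one_iff[of q i] by auto
    have d0: "d > 0" using odd_d by (auto intro: Nat.gr0I)
    have eq1: "poly t (q\<^sup>2) * (1 - (q ^ d)\<^sup>2) = (1 - q\<^sup>2) * poly (gauss_poly n r) (q\<^sup>2)"
      using arg_cong[OF t(1), of "\<lambda>p. poly p (q\<^sup>2)"]
      by (simp add: one_minus_pow_def poly_monom power_mult[symmetric] mult.commute[of 2])
    have eq2: "poly y q * (1 - q ^ N) = poly (gauss_poly N n) q * (1 - q ^ d)"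
      using arg_cong[OF y, of "\<lambda>p. poly p q"] by (simp add: one_minus_pow_def poly_monom)
    have eq3: "(1 + q) * poly (alt_poly d) q = 1 + q ^ d"
      using arg_cong[OF alt_poly_mult[OF odd_d], of "\<lambda>p. poly p q"] by (simp add: poly_monom)
    have nz: "(1 - q ^ d) * (1 + q ^ d) * (1 + q) \<noteq> 0"
      using q1[OF d0] q by (simp add: add_pos_pos pos_add_strict less_imp_neq[symmetric])
    \<comment> \<open>The three factors of p are multiplied after clearing denominators: 1 - q^(2d)
      from t(q^2) cancels against 1 - q^d from y and 1 + q^d from \<open>alt_poly d\<close>, and 1 -
      q^2 over 1 + q leaves 1 - q.\<close>
    have "((1 - q ^ d) * (1 + q ^ d) * (1 + q)) * (poly t (q\<^sup>2) * poly y q * poly (alt_poly d) q * (1 - q ^ N)) =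
       (poly t (q\<^sup>2) * (1 - (q ^ d)\<^sup>2)) * (poly y q * (1 - q ^ N)) * ((1 + q) * poly (alt_poly d) q)"
      by (simp add: power2_eq_square algebra_simps)
    also have "\<dots> = ((1 - q ^ d) * (1 + q ^ d) * (1 + q)) *
        ((1 - q) * poly (gauss_poly n r) (q\<^sup>2) * poly (gauss_poly N n) q)"
      unfolding eq1 eq2 eq3 by (simp add: power2_eq_square algebra_simps)
    finally have "poly t (q\<^sup>2) * poly y q * poly (alt_poly d) q * (1 - q ^ N) =
        (1 - q) * poly (gauss_poly n r) (q\<^sup>2) * poly (gauss_poly N n) q"
      using nz mult_left_cancel by blast
    then have eq: "poly t (q\<^sup>2) * poly y q * poly (alt_poly d) q =
        (1 - q) * poly (gauss_poly n r) (q\<^sup>2) * poly (gauss_poly N n) q / (1 - q ^ N)"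
      using q1[OF N(2)] by (simp add: eq_divide_eq)
    have "poly p q = q ^ (r\<^sup>2 - r) * (poly t (q\<^sup>2) * poly y q * poly (alt_poly d) q)"
      by (simp add: p_def s_def poly_pcompose poly_monom mult.assoc)
    then show ?thesis
      unfolding eq using T_eq_gauss[OF rm q] by (simp add: n N_def mult_ac)
  qed
  show ?thesis
  proof (cases "n = 2 * r - 1")
    case True
    \<comment> \<open>The boundary case m = r - 1. As n is odd, the claim for even n is
      vacuous.\<close>
    then have nN: "n = N" using n assms(1) by (simp add: N_def)
    then have "d = N" by (simp add: d_def)
    with y nN N(2) have "y = 1" by simp
    have X: "[:1, 1:] = 1 + monom (1::real) 1" by (simp add: monom_altdef one_pCons)
    have "[:1, 1:] * p = monom 1 (r\<^sup>2 - r) * s * (1 + monom 1 d)"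
      unfolding p_def \<open>y = 1\<close> X alt_poly_mult[OF odd_d, symmetric]
      by (simp only: mult_ac mult_1)
    then have odd_case: "positive_poly ([:1, 1:] * p)"
      using s by (auto intro!: positive_poly_mult positive_poly_add)
    have neg: "[:0, -1:] = monom (- 1 :: real) 1" by (simp add: monom_altdef)
    \<comment> \<open>Since s is even in q and r^2 - r is an even number, -q affects only
      \<open>alt_poly d\<close>, whose alternating signs disappear.\<close>
    have "pcompose s [:0, -1:] = s"
      by (simp add: s_def pcompose_assoc[symmetric] pcompose_monom_left neg monom_power)
    moreover have "pcompose (monom 1 (r\<^sup>2 - r)) [:0, -1:] = monom (1::real) (r\<^sup>2 - r)"
      by (simp add: pcompose_monom_left neg monom_power power2_eq_square)
    moreover have "pcompose (alt_poly d) [:0, -1:] = (\<Sum>i<d. monom 1 i)"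
      by (simp add: alt_poly_def pcompose_sum pcompose_monom_left neg monom_power smult_monom
          power_mult_distrib[symmetric])
    ultimately have "positive_poly (pcompose p [:0, -1:])"
      using s by (auto simp: p_def pcompose_mult \<open>y = 1\<close> intro!: positive_poly_mult positive_poly_sum)
    with odd_case eval True show ?thesis using assms(1) by (intro exI[of _ p]) auto
  next
    case False
    \<comment> \<open>Away from the boundary case p itself is positive for either parity of
      n.\<close>
    then have "n < N" using n rm assms by (simp add: N_def)
    then have "positive_poly (y * alt_poly d)"
      using assms N(1) y by (intro positive_rational_gauss_poly[of N n]) (auto simp: d_def)
    then have p: "positive_poly p"
      unfolding p_def using s by (simp add: positive_poly_mult)
    have "positive_poly ([:1, 1:] :: real poly)"
      by (auto simp: positive_poly_def coeff_pCons split: nat.split)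
    from positive_poly_mult[OF this p] p eval False show ?thesis by blast
  qed
qed

end
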